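(* Let $0\le \alpha<1$. Then (i) $R_{\mathcal{S}^*(\alpha)}(\mathcal{T}_1)=R_{\mathcal{S}^*_\alpha}(\mathcal{T}_1)=\dfrac{2(1-\alpha)}{5-2\alpha}$; (ii) $R_{\mathcal{S}^*(\alpha)}(\mathcal{T}_2)=R_{\mathcal{S}^*_\alpha}(\mathcal{T}_2)=\dfrac{1-\alpha}{3}$.
   Context: $\mathbb{D}=\{z\in\mathbb{C}:|z|<1\}$; $\mathcal{A}$ is the class of analytic functions $f$ on $\mathbb{D}$ with $f(0)=0$, $f'(0)=1$. For analytic $F,G$ on $\mathbb{D}$, $F\prec G$ (subordination) means $F(z)=G(w(z))$ on $\mathbb{D}$ for some analytic $w:\mathbb{D}\to\mathbb{D}$ with $|w(z)|\le|z|$. Quotients such as $f(z)/g(z)$, $g(z)/(zp(z))$, $zf'(z)/f(z)$ are understood as analytic functions on $\mathbb{D}$ with the removable singularity at $0$ filled in (value of $zf'(z)/f(z)$ at $0$ is $1$). $\sqrt{1+z}$ is the principal branch. $\mathcal{T}_1$ is the class of $f\in\mathcal{A}$ for which there exist $g\in\mathcal{A}$ and an analytic $p$ on $\mathbb{D}$ with $f(z)/g(z)\prec\sqrt{1+z}$, $g(z)/(zp(z))\prec\sqrt{1+z}$, $p(z)\prec\sqrt{1+z}$. $\mathcal{T}_2$ is the class of $f\in\mathcal{A}$ for which there exist $g\in\mathcal{A}$ and an analytic $p$ on $\mathbb{D}$ with $f(z)/g(z)\prec e^z$, $g(z)/(zp(z))\prec e^z$, $p(z)\prec e^z$. For $\mathcal{G},\mathcal{M}\subset\mathcal{A}$,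 the $\mathcal{G}$-radius $R_{\mathcal{G}}(\mathcal{M})$ is the largest number $R$ such that the function $z\mapsto r^{-1}f(rz)$ belongs to $\mathcal{G}$ for every $0<r\le R$ and every $f\in\mathcal{M}$. For $0\le\alpha<1$: $\mathcal{S}^*(\alpha)$ (starlike functions of order $\alpha$) is the class of $f\in\mathcal{A}$ with $zf'(z)/f(z)\prec(1+(1-2\alpha)z)/(1-z)$, i.e. $\operatorname{Re}(zf'(z)/f(z))>\alpha$ on $\mathbb{D}$; $\mathcal{S}^*_\alpha$ is the class of $f\in\mathcal{A}$ with $|zf'(z)/f(z)-1|<1-\alpha$ on $\mathbb{D}$. *)

theory Defs
  imports "HOL-Complex_Analysis.Complex_Analysis"
begin

text \<open>
  Functions on the open unit disc are total functions on \<^typ>\<open>complex\<close>; every notion below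
  depends only on their values on the disc.
\<close>

abbreviation unit_disc :: "complex set" where
  "unit_disc \<equiv> ball 0 1"

definition class_A :: "(complex \<Rightarrow> complex) set" where
  "class_A = {f. f holomorphic_on unit_disc \<and> f 0 = 0 \<and> deriv f 0 = 1}"

definition subordinate :: "(complex \<Rightarrow> complex) \<Rightarrow> (complex \<Rightarrow> complex) \<Rightarrow> bool"
  (infix \<open>\<prec>\<^sub>D\<close> 50) where
  "F \<prec>\<^sub>D G \<longleftrightarrow>
     F holomorphic_on unit_disc \<and> G holomorphic_on unit_disc \<and>
     (\<exists>w. w holomorphic_on unit_disc \<and> w ` unit_disc \<subseteq> unit_disc \<and>
          (\<forall>z\<in>unit_disc. norm (w z) \<le> norm z \<and> F z = G (w z)))"

text \<open>
  Quotients are wrapped in \<^const>\<open>remove_sings\<close>, which fills in the removable singularity at 0.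
  It gives the value 0 at poles, but this admits no additional functions below: the resulting
  function is required to be holomorphic or bounded on the disc, hence there are no poles in it.
\<close>

text \<open>The common shape of the two classes: \<open>\<phi>\<close> is the superordinate function.\<close>

definition class_T :: "(complex \<Rightarrow> complex) \<Rightarrow> (complex \<Rightarrow> complex) set" where
  "class_T \<phi> = {f \<in> class_A. \<exists>g\<in>class_A. \<exists>p. p holomorphic_on unit_disc \<and>
     remove_sings (\<lambda>z. f z / g z) \<prec>\<^sub>D \<phi> \<and>
     remove_sings (\<lambda>z. g z / (z * p z)) \<prec>\<^sub>D \<phi> \<and>
     p \<prec>\<^sub>D \<phi>}"

definition class_T1 :: "(complex \<Rightarrow> complex) set" where
  "class_T1 = class_T (\<lambda>z. csqrt (1 + z))"

definition class_T2 :: "(complex \<Rightarrow> complex) set" where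
  "class_T2 = class_T (\<lambda>z. exp z)"

definition starlike_quot :: "(complex \<Rightarrow> complex) \<Rightarrow> complex \<Rightarrow> complex" where
  "starlike_quot f = remove_sings (\<lambda>z. z * deriv f z / f z)"

text \<open>\<open>starlike_order \<alpha>\<close> is $\mathcal{S}^*(\alpha)$, and \<open>starlike_disc \<alpha>\<close> is
  $\mathcal{S}^*_\alpha$.\<close>

definition starlike_order :: "real \<Rightarrow> (complex \<Rightarrow> complex) set" where
  "starlike_order \<alpha> = {f \<in> class_A.
     starlike_quot f \<prec>\<^sub>D (\<lambda>z. (1 + (1 - 2 * complex_of_real \<alpha>) * z) / (1 - z))}"

definition starlike_disc :: "real \<Rightarrow> (complex \<Rightarrow> complex) set" where
  "starlike_disc \<alpha> = {f \<in> class_A. \<forall>z\<in>unit_disc. norm (starlike_quot f z - 1) < 1 - \<alpha>}"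

text \<open>
  Only \<open>R \<le> 1\<close> is considered, since for \<open>r > 1\<close> the function \<open>z \<mapsto> f (r z) / r\<close> is not
  determined on the disc by the values of \<open>f\<close> there.
\<close>

definition radius_admissible ::
  "(complex \<Rightarrow> complex) set \<Rightarrow> (complex \<Rightarrow> complex) set \<Rightarrow> real \<Rightarrow> bool" where
  "radius_admissible G M R \<longleftrightarrow> 0 < R \<and> R \<le> 1 \<and>
     (\<forall>r f. 0 < r \<and> r \<le> R \<and> f \<in> M \<longrightarrow>
        (\<lambda>z. f (complex_of_real r * z) / complex_of_real r) \<in> G)"

text \<open>
  \<open>is_radius G M R\<close> says that the \<open>G\<close>-radius of \<open>M\<close> exists and equals \<open>R\<close>. It is a predicate
  because a largest admissible number need not exist for arbitrary \<open>G\<close> and \<open>M\<close>.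
\<close>

definition is_radius ::
  "(complex \<Rightarrow> complex) set \<Rightarrow> (complex \<Rightarrow> complex) set \<Rightarrow> real \<Rightarrow> bool" where
  "is_radius G M R \<longleftrightarrow>
     radius_admissible G M R \<and> (\<forall>R'. radius_admissible G M R' \<longrightarrow> R' \<le> R)"

end

theory Submission
  imports Defs
begin

text \<open>
  A function \<open>f\<close> in the class attached to \<open>\<phi>\<close> is a product
  \<open>z * \<phi> (w\<^sub>1 z) * \<phi> (w\<^sub>2 z) * \<phi> (w\<^sub>3 z)\<close>, where each \<open>w\<^sub>i\<close> is a holomorphic self-map of the disc
  with \<open>norm (w\<^sub>i z) \<le> norm z\<close> (lemma \<open>class_T_factorization\<close>). Its starlikeness quotient
  \<open>z f' / f\<close> is therefore \<open>1\<close> plus three terms of the form \<open>z * w' * \<phi>' (w) / \<phi> (w)\<close>, and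
  the quotient stays within \<open>1 - \<alpha>\<close> of \<open>1\<close> wherever each term is smaller than
  \<open>(1 - \<alpha>) / 3\<close>. The resulting disc of radius \<open>1 - \<alpha>\<close> about \<open>1\<close> lies in the half-plane
  \<open>Re > \<alpha>\<close> and touches its boundary at \<open>\<alpha>\<close>, which is why both notions of
  starlikeness have the same radius.

  Let \<open>r = norm z\<close>. For \<open>\<phi> z = csqrt (1 + z)\<close> each term is \<open>z * w' / (2 * (1 + w))\<close>, and the
  Schwarz-Pick inequality bounds it by \<open>r / (2 * (1 - r))\<close>; this is less than
  \<open>(1 - \<alpha>) / 3\<close> exactly for \<open>r < 2 * (1 - \<alpha>) / (5 - 2 * \<alpha>)\<close>. For \<open>\<phi> = exp\<close> each term
  is \<open>z * w'\<close>, and Dieudonne's result that \<open>norm w' \<le> 1\<close> for \<open>r \<le> sqrt 2 - 1\<close>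
  (lemma \<open>Schwarz_map_deriv_le_1\<close>) bounds it by \<open>r\<close>; it applies because
  \<open>(1 - \<alpha>) / 3 \<le> 1 / 3 < sqrt 2 - 1\<close>.

  Both bounds are attained at \<open>z = - r\<close> by \<open>w z = z\<close>. Hence \<open>z * \<phi> z ^ 3\<close>, which
  belongs to the class, has quotient exactly \<open>\<alpha>\<close> at \<open>- R\<close>, so no larger radius is possible.
  The lemma \<open>radius_class_T\<close> carries out this argument for any \<open>\<phi>\<close> for which such a
  sharp bound is known.
\<close>

section \<open>Derivatives of self-maps of the disc\<close>

lemma has_field_derivative_Moebius:
  assumes "1 - cnj a * z \<noteq> 0"
  shows "(Moebius_function 0 a has_field_derivative (1 - cnj a * a) / (1 - cnj a * z)\<^sup>2) (at z)"
proof -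
  have "((\<lambda>z. (z - a) / (1 - cnj a * z)) has_field_derivative
          (1 - cnj a * a) / (1 - cnj a * z)\<^sup>2) (at z)"
    using assms by (auto intro!: derivative_eq_intros simp: field_simps power2_eq_square)
  then show ?thesis
    by (simp add: Moebius_function_simple[abs_def])
qed

text \<open>
  Composing \<open>f\<close> with the disc automorphisms that move \<open>0\<close> to \<open>a\<close> and \<open>f a\<close> to \<open>0\<close> gives a
  self-map of the disc that fixes \<open>0\<close>; the Schwarz lemma bounds its derivative there by \<open>1\<close>, and
  the chain rule turns this into the claim.
\<close>

lemma Schwarz_Pick_derivative:
  assumes holf: "f holomorphic_on ball 0 1"
    and f_less: "\<And>z. norm z < 1 \<Longrightarrow> norm (f z) < 1"
    and a: "norm a < 1"
  shows "norm (deriv f a) * (1 - (norm a)\<^sup>2) \<le> 1 - (norm (f a))\<^sup>2"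
proof -
  define b where "b = f a"
  define F where "F = (\<lambda>z. Moebius_function 0 b (f (Moebius_function 0 (- a) z)))"
  have b: "norm b < 1"
    using f_less a by (simp add: b_def)
  have a': "norm (- a) < 1" using a by simp
  have sq: "cnj c * c = of_real ((norm c)\<^sup>2)" for c
    by (metis complex_norm_square mult.commute)
  have pos: "0 < 1 - (norm c)\<^sup>2" if "norm c < 1" for c :: complex
    using that by (simp add: power_less_one_iff abs_square_less_1)
  have nz: "1 - cnj b * b \<noteq> 0"
    using pos[OF b] unfolding sq by (metis less_irrefl of_real_1 of_real_diff of_real_eq_0_iff)
  have M0: "Moebius_function 0 (- a) 0 = a"
    by (simp add: Moebius_function_of_zero)
  have lt: "norm (Moebius_function 0 (- a) z) < 1" if "norm z < 1" for z
    using Moebius_function_norm_lt_1[OF a' that] .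
  have holF: "F holomorphic_on ball 0 1"
  proof -
    have "f \<circ> Moebius_function 0 (- a) holomorphic_on ball 0 1"
      by (rule holomorphic_on_compose_gen[OF Moebius_function_holomorphic[OF a'] holf])
        (use lt in auto)
    then have "Moebius_function 0 b \<circ> (f \<circ> Moebius_function 0 (- a)) holomorphic_on ball 0 1"
      by (rule holomorphic_on_compose_gen[OF _ Moebius_function_holomorphic[OF b]])
        (use lt f_less in auto)
    then show ?thesis by (simp add: F_def o_def)
  qed
  have F0: "F 0 = 0"
    by (simp add: F_def M0 b_def Moebius_function_eq_zero)
  have F_less: "norm (F z) < 1" if "norm z < 1" for z
    unfolding F_def by (intro Moebius_function_norm_lt_1 b f_less lt that)
  have "(f has_field_derivative deriv f a) (at a)"
    using holf a by (intro holomorphic_derivI[where S = "ball 0 1"]) auto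
  then have d1: "(f has_field_derivative deriv f a) (at (Moebius_function 0 (- a) 0))"
    by (simp add: M0)
  have d2: "(Moebius_function 0 (- a) has_field_derivative (1 - cnj a * a)) (at 0)"
    using has_field_derivative_Moebius[of "- a" 0] by simp
  have d3: "(Moebius_function 0 b has_field_derivative 1 / (1 - cnj b * b))
              (at (f (Moebius_function 0 (- a) 0)))"
    using has_field_derivative_Moebius[of b b] nz
    by (simp add: M0 flip: b_def) (simp add: power2_eq_square)
  have "(F has_field_derivative 1 / (1 - cnj b * b) * (deriv f a * (1 - cnj a * a))) (at 0)"
    unfolding F_def by (rule DERIV_chain2[OF d3 DERIV_chain2[OF d1 d2]])
  then have "deriv F 0 = 1 / (1 - cnj b * b) * (deriv f a * (1 - cnj a * a))"
    by (rule DERIV_imp_deriv)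
  moreover have "norm (deriv F 0) \<le> 1"
    using Schwarz_Lemma(2)[OF holF F0 F_less, of 0] by simp
  moreover have "norm (1 - cnj c * c) = 1 - (norm c)\<^sup>2" if "norm c < 1" for c
  proof -
    have "1 - cnj c * c = of_real (1 - (norm c)\<^sup>2)" by (simp add: sq)
    then show ?thesis using pos[OF that] by (simp del: of_real_diff)
  qed
  ultimately have "norm (deriv f a) * (1 - (norm a)\<^sup>2) / (1 - (norm b)\<^sup>2) \<le> 1"
    using a b by (simp add: norm_mult norm_divide)
  then show ?thesis
    using pos[OF b] by (simp add: b_def divide_le_eq)
qed

text \<open>The functions that mediate a subordination.\<close>

definition Schwarz_map :: "(complex \<Rightarrow> complex) \<Rightarrow> bool" where
  "Schwarz_map w \<longleftrightarrow> w holomorphic_on unit_disc \<and> w ` unit_disc \<subseteq> unit_disc \<and>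
     (\<forall>z\<in>unit_disc. norm (w z) \<le> norm z)"

lemma Schwarz_mapD:
  assumes "Schwarz_map w"
  shows "w holomorphic_on unit_disc" "\<And>z. norm z < 1 \<Longrightarrow> norm (w z) < 1"
    "\<And>z. norm z < 1 \<Longrightarrow> norm (w z) \<le> norm z" "w 0 = 0"
proof -
  show "w holomorphic_on unit_disc" and less: "\<And>z. norm z < 1 \<Longrightarrow> norm (w z) < 1"
    and le: "\<And>z. norm z < 1 \<Longrightarrow> norm (w z) \<le> norm z"
    using assms by (auto simp: Schwarz_map_def image_subset_iff)
  show "w 0 = 0" using le[of 0] by simp
qed

lemma Schwarz_map_ident: "Schwarz_map (\<lambda>z. z)"
  by (simp add: Schwarz_map_def)

text \<open>
  Dieudonne's theorem; the condition on \<open>r = norm z\<close> says \<open>r \<le> sqrt 2 - 1\<close>. Writing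
  \<open>w z = z * h z\<close> gives \<open>w' = h + z * h'\<close>. If \<open>h\<close> maps into the open disc, the Schwarz-Pick
  inequality for \<open>h\<close> yields \<open>norm w' \<le> t + r * (1 - t\<^sup>2) / (1 - r\<^sup>2)\<close> with \<open>t = norm (h z)\<close>,
  and this is at most \<open>t + (1 - t\<^sup>2) / 2 = 1 - (1 - t)\<^sup>2 / 2\<close>. Otherwise \<open>w\<close> is a rotation.
\<close>

lemma Schwarz_map_deriv_le_1:
  assumes w: "Schwarz_map w" and z: "norm z < 1" "2 * norm z \<le> 1 - (norm z)\<^sup>2"
  shows "norm (deriv w z) \<le> 1"
proof -
  note wD = Schwarz_mapD[OF w]
  obtain h where holh: "h holomorphic_on ball 0 1"
    and weq: "\<And>z. norm z < 1 \<Longrightarrow> w z = z * h z" and w0: "deriv w 0 = h 0"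
    using Schwarz3[OF wD(1,4)] by auto
  note dz = Schwarz_Lemma[OF wD(1,4,2)]
  show ?thesis
  proof (cases "\<exists>u. norm u < 1 \<and> norm (h u) \<ge> 1")
    case True
    then obtain u where u: "norm u < 1" "norm (h u) \<ge> 1" by auto
    have "(\<exists>z. norm z < 1 \<and> z \<noteq> 0 \<and> norm (w z) = norm z) \<or> norm (deriv w 0) = 1"
    proof (cases "u = 0")
      case True
      then show ?thesis using u dz(2)[of 0] w0 by auto
    next
      case False
      have "norm (w u) \<ge> norm u"
        using weq[OF u(1)] u(2) by (simp add: norm_mult mult_left_le mult_le_cancel_left1)
      with wD(3)[OF u(1)] False u show ?thesis by force
    qed
    then obtain c where c: "\<And>z. norm z < 1 \<Longrightarrow> w z = c * z" "norm c = 1"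
      using dz(3)[of 0] by auto
    have "(w has_field_derivative c) (at z)"
    proof (rule has_field_derivative_transform_within_open[where S = "ball 0 1"])
      show "((\<lambda>z. c * z) has_field_derivative c) (at z)"
        by (auto intro!: derivative_eq_intros)
    qed (use z c in auto)
    then show ?thesis using c(2) by (simp add: DERIV_imp_deriv)
  next
    case False
    then have h_less: "norm (h u) < 1" if "norm u < 1" for u
      using that by (meson not_le)
    have hd: "(h has_field_derivative deriv h z) (at z)"
      using holh z by (intro holomorphic_derivI[where S = "ball 0 1"]) auto
    have "(w has_field_derivative h z + z * deriv h z) (at z)"
    proof (rule has_field_derivative_transform_within_open[where S = "ball 0 1"])
      show "((\<lambda>z. z * h z) has_field_derivative h z + z * deriv h z) (at z)"
        by (rule derivative_eq_intros refl hd)+ (simp add: algebra_simps)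
    qed (use z weq in auto)
    then have "deriv w z = h z + z * deriv h z"
      by (rule DERIV_imp_deriv)
    then have "norm (deriv w z) \<le> norm (h z) + norm z * norm (deriv h z)"
      by (metis norm_mult norm_triangle_ineq)
    also have "\<dots> \<le> norm (h z) + (1 - (norm (h z))\<^sup>2) / 2"
    proof -
      have "2 * norm z * norm (deriv h z) \<le> (1 - (norm z)\<^sup>2) * norm (deriv h z)"
        using z by (intro mult_right_mono) auto
      also have "\<dots> \<le> 1 - (norm (h z))\<^sup>2"
        using Schwarz_Pick_derivative[OF holh h_less z(1)] by (simp add: mult.commute)
      finally show ?thesis by simp
    qed
    also have "\<dots> \<le> 1"
      using zero_le_power2[of "1 - norm (h z)"] by (simp add: power2_diff field_simps)
    finally show ?thesis .
  qed
qed

section \<open>Quotients with a removable singularity\<close>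

text \<open>Evaluates a filled-in quotient when a holomorphic candidate for it is known.\<close>

lemma remove_sings_quotient:
  assumes hol: "f holomorphic_on unit_disc" "g holomorphic_on unit_disc" "q holomorphic_on unit_disc"
    and feq: "\<And>z. z \<in> unit_disc \<Longrightarrow> f z = g z * q z"
    and gnz: "\<And>z. z \<in> unit_disc \<Longrightarrow> z \<noteq> 0 \<Longrightarrow> g z \<noteq> 0"
    and z: "z \<in> unit_disc"
  shows "remove_sings (\<lambda>z. f z / g z) z = q z"
proof -
  have "eventually (\<lambda>u. u \<in> unit_disc) (at z)"
    using z by (intro eventually_at_in_open') auto
  moreover have "eventually (\<lambda>u. u \<noteq> 0) (at z)"
    by (rule eventually_neq_at_within)
  ultimately have "eventually (\<lambda>u. f u / g u = q u) (at z)"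
    by eventually_elim (use feq gnz in auto)
  then have "remove_sings (\<lambda>z. f z / g z) z = remove_sings q z"
    by (rule remove_sings_cong) simp
  also have "\<dots> = q z"
    using hol(3) z by (intro remove_sings_at_analytic holomorphic_on_imp_analytic_at) auto
  finally show ?thesis .
qed

text \<open>
  The zeros of \<open>g\<close> are isolated, and off them the filled-in quotient is the ordinary one. Both sides
  are continuous, so the identity extends to the zeros of \<open>g\<close>.
\<close>

lemma remove_sings_quotient_cancel:
  assumes hol: "f holomorphic_on unit_disc" "g holomorphic_on unit_disc"
    and holq: "remove_sings (\<lambda>z. f z / g z) holomorphic_on unit_disc"
    and b: "b \<in> unit_disc" "g b \<noteq> 0"
    and z: "z \<in> unit_disc"
  shows "f z = g z * remove_sings (\<lambda>z. f z / g z) z"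
proof -
  let ?q = "remove_sings (\<lambda>z. f z / g z)"
  have "eventually (\<lambda>u. g u \<noteq> 0 \<and> u \<in> unit_disc) (at z)"
    by (rule non_zero_neighbour_alt[OF hol(2) _ _ z b]) auto
  then have ev: "eventually (\<lambda>u. g u * ?q u = f u) (at z)"
  proof eventually_elim
    case (elim u)
    have "f analytic_on {u}" "g analytic_on {u}"
      using elim hol by (auto intro: holomorphic_on_imp_analytic_at[OF _ open_ball])
    then have "(\<lambda>z. f z / g z) analytic_on {u}"
      using elim by (intro analytic_on_divide) auto
    then show ?case using elim by simp
  qed
  have c: "F \<midarrow>z\<rightarrow> F z" if "F holomorphic_on unit_disc" for F :: "complex \<Rightarrow> complex"
    using that z
    by (metis open_ball continuous_on_eq_continuous_at holomorphic_on_imp_continuous_on isContD)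
  have "(\<lambda>u. g u * ?q u) \<midarrow>z\<rightarrow> g z * ?q z"
    by (intro tendsto_mult c hol holq)
  then have "f \<midarrow>z\<rightarrow> g z * ?q z"
    using ev by (simp add: filterlim_cong)
  then show ?thesis
    using LIM_unique[OF c[OF hol(1)]] by blast
qed

section \<open>Factorization of the functions in the class\<close>

lemma subordinate_Schwarz_map:
  assumes "F \<prec>\<^sub>D \<phi>"
  obtains w where "Schwarz_map w" "\<And>z. z \<in> unit_disc \<Longrightarrow> F z = \<phi> (w z)"
  using assms unfolding subordinate_def Schwarz_map_def by blast

lemma holomorphic_compose_Schwarz_map:
  assumes "\<phi> holomorphic_on unit_disc" "Schwarz_map w"
  shows "(\<lambda>z. \<phi> (w z)) holomorphic_on unit_disc"
  using assms holomorphic_on_compose_gen[of w unit_disc \<phi> unit_disc]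
  by (auto simp: Schwarz_map_def o_def)

text \<open>
  Each of the three subordinations is solved for its numerator. The non-vanishing of \<open>\<phi>\<close> ensures
  that the denominators \<open>z * p z\<close> and \<open>g\<close> are not identically zero; the point \<open>1/2\<close> serves as
  a witness.
\<close>

lemma class_T_factorization:
  assumes nz: "\<And>z. z \<in> unit_disc \<Longrightarrow> \<phi> z \<noteq> 0"
    and f: "f \<in> class_T \<phi>"
  obtains w1 w2 w3 where "Schwarz_map w1" "Schwarz_map w2" "Schwarz_map w3"
    "\<And>z. z \<in> unit_disc \<Longrightarrow> f z = z * (\<phi> (w1 z) * \<phi> (w2 z) * \<phi> (w3 z))"
proof -
  obtain g p where fA: "f \<in> class_A" and gA: "g \<in> class_A" and holp: "p holomorphic_on unit_disc"
    and s1: "remove_sings (\<lambda>z. f z / g z) \<prec>\<^sub>D \<phi>"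
    and s2: "remove_sings (\<lambda>z. g z / (z * p z)) \<prec>\<^sub>D \<phi>" and s3: "p \<prec>\<^sub>D \<phi>"
    using f unfolding class_T_def by blast
  obtain w1 where w1: "Schwarz_map w1"
    "\<And>z. z \<in> unit_disc \<Longrightarrow> remove_sings (\<lambda>z. f z / g z) z = \<phi> (w1 z)"
    using subordinate_Schwarz_map[OF s1] by blast
  obtain w2 where w2: "Schwarz_map w2"
    "\<And>z. z \<in> unit_disc \<Longrightarrow> remove_sings (\<lambda>z. g z / (z * p z)) z = \<phi> (w2 z)"
    using subordinate_Schwarz_map[OF s2] by blast
  obtain w3 where w3: "Schwarz_map w3" "\<And>z. z \<in> unit_disc \<Longrightarrow> p z = \<phi> (w3 z)"
    using subordinate_Schwarz_map[OF s3] by blast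
  have hol: "f holomorphic_on unit_disc" "g holomorphic_on unit_disc"
    using fA gA by (auto simp: class_A_def)
  have holzp: "(\<lambda>z. z * p z) holomorphic_on unit_disc"
    by (intro holomorphic_intros holp)
  have nz_w: "\<phi> (w z) \<noteq> 0" if "Schwarz_map w" "z \<in> unit_disc" for w z
    using that nz Schwarz_mapD(2)[OF that(1), of z] by auto
  have half: "(1/2 :: complex) \<in> unit_disc" by simp
  have pz: "1/2 * p (1/2) \<noteq> 0"
    using nz_w[OF w3(1) half] w3(2)[OF half] by simp
  have geq: "g z = z * p z * \<phi> (w2 z)" if "z \<in> unit_disc" for z
    using remove_sings_quotient_cancel[OF hol(2) holzp _ half pz that] s2 w2(2)[OF that]
    by (simp add: subordinate_def)
  have gz: "g (1/2) \<noteq> 0"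
    unfolding geq[OF half] using pz nz_w[OF w2(1) half] by simp
  have feq: "f z = g z * \<phi> (w1 z)" if "z \<in> unit_disc" for z
    using remove_sings_quotient_cancel[OF hol(1,2) _ half gz that] s1 w1(2)[OF that]
    by (simp add: subordinate_def)
  show ?thesis
    by (rule that[OF w1(1) w2(1) w3(1)]) (simp add: feq geq w3(2))
qed

lemma class_A_times_ident:
  assumes "H holomorphic_on unit_disc" "H 0 = 1"
  shows "(\<lambda>z. z * H z) \<in> class_A"
proof -
  have "(H has_field_derivative deriv H 0) (at 0)"
    using assms by (intro holomorphic_derivI[where S = unit_disc]) auto
  then have "((\<lambda>z. z * H z) has_field_derivative H 0) (at 0)"
    by (auto intro!: derivative_eq_intros)
  then have "deriv (\<lambda>z. z * H z) 0 = H 0"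
    by (rule DERIV_imp_deriv)
  then show ?thesis
    using assms by (auto simp: class_A_def intro!: holomorphic_intros)
qed

text \<open>
  The extremal function: all three subordinations are equalities when \<open>p = \<phi>\<close> and
  \<open>g z = z * \<phi> z ^ 2\<close>.
\<close>

lemma cube_in_class_T:
  assumes hol: "\<phi> holomorphic_on unit_disc"
    and nz: "\<And>z. z \<in> unit_disc \<Longrightarrow> \<phi> z \<noteq> 0"
    and one: "\<phi> 0 = 1"
  shows "(\<lambda>z. z * \<phi> z ^ 3) \<in> class_T \<phi>"
proof -
  have sub: "F \<prec>\<^sub>D \<phi>" if "\<And>z. z \<in> unit_disc \<Longrightarrow> F z = \<phi> z" for F
    unfolding subordinate_def
    using that hol Schwarz_map_ident holomorphic_cong[of unit_disc unit_disc F \<phi>]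
    by (auto simp: Schwarz_map_def intro!: exI[of _ "\<lambda>z. z"])
  have "(\<lambda>z. z * \<phi> z ^ 3) \<in> class_A" and g: "(\<lambda>z. z * \<phi> z ^ 2) \<in> class_A"
    by (rule class_A_times_ident; use hol one in \<open>auto intro!: holomorphic_intros\<close>)+
  moreover have "remove_sings (\<lambda>z. (z * \<phi> z ^ 3) / (z * \<phi> z ^ 2)) \<prec>\<^sub>D \<phi>"
    by (rule sub, rule remove_sings_quotient)
      (use hol nz in \<open>auto intro!: holomorphic_intros simp: power2_eq_square power3_eq_cube\<close>)
  moreover have "remove_sings (\<lambda>z. (z * \<phi> z ^ 2) / (z * \<phi> z)) \<prec>\<^sub>D \<phi>"
    by (rule sub, rule remove_sings_quotient)
      (use hol nz in \<open>auto intro!: holomorphic_intros simp: power2_eq_square\<close>)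
  moreover have "\<phi> \<prec>\<^sub>D \<phi>" by (rule sub) simp
  ultimately show ?thesis
    unfolding class_T_def using hol g by (intro CollectI conjI bexI[OF _ g] exI[of _ \<phi>])
qed

section \<open>The starlikeness quotient\<close>

lemma starlike_quot_times_ident:
  assumes hol: "H holomorphic_on unit_disc"
    and nz: "\<And>z. z \<in> unit_disc \<Longrightarrow> H z \<noteq> 0"
    and f: "\<And>z. z \<in> unit_disc \<Longrightarrow> f z = z * H z"
    and z: "z \<in> unit_disc"
  shows "starlike_quot f z = 1 + z * deriv H z / H z"
proof -
  have holf: "f holomorphic_on unit_disc"
    using f hol holomorphic_cong[of unit_disc unit_disc f "\<lambda>z. z * H z"]
    by (auto intro!: holomorphic_intros)
  have df: "deriv f u = H u + u * deriv H u" if u: "u \<in> unit_disc" for u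
  proof (rule DERIV_imp_deriv, rule has_field_derivative_transform_within_open[where S = unit_disc])
    have hd: "(H has_field_derivative deriv H u) (at u)"
      using hol u by (intro holomorphic_derivI[where S = unit_disc]) auto
    show "((\<lambda>z. z * H z) has_field_derivative H u + u * deriv H u) (at u)"
      by (rule derivative_eq_intros refl hd)+ (simp add: algebra_simps)
  qed (use u f in auto)
  show ?thesis
    unfolding starlike_quot_def
  proof (rule remove_sings_quotient[OF _ holf _ _ _ z])
    show "(\<lambda>z. z * deriv f z) holomorphic_on unit_disc"
      by (intro holomorphic_intros holf) auto
    show "(\<lambda>z. 1 + z * deriv H z / H z) holomorphic_on unit_disc"
      by (intro holomorphic_intros hol) (use nz in auto)
  qed (use f nz df in \<open>auto simp: field_simps\<close>)
qed

lemma dilate_in_disc: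
  assumes "0 < r" "r \<le> 1" "z \<in> unit_disc"
  shows "of_real r * z \<in> unit_disc"
  using assms mult_left_le_one_le[of "norm z" r] by (simp add: norm_mult)

lemma holomorphic_on_dilation:
  assumes "F holomorphic_on unit_disc" "0 < r" "r \<le> 1"
  shows "(\<lambda>z. F (of_real r * z)) holomorphic_on unit_disc"
proof -
  have "F \<circ> (\<lambda>z. of_real r * z) holomorphic_on unit_disc"
    by (rule holomorphic_on_compose_gen[OF _ assms(1)])
      (use dilate_in_disc[OF assms(2,3)] in \<open>auto intro!: holomorphic_intros simp del: mem_ball_0\<close>)
  then show ?thesis by (simp add: o_def)
qed

lemma starlike_quot_dilation:
  assumes hol: "H holomorphic_on unit_disc"
    and nz: "\<And>z. z \<in> unit_disc \<Longrightarrow> H z \<noteq> 0"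
    and f: "\<And>z. z \<in> unit_disc \<Longrightarrow> f z = z * H z"
    and r: "0 < r" "r \<le> 1"
    and z: "z \<in> unit_disc"
  shows "starlike_quot (\<lambda>z. f (of_real r * z) / of_real r) z =
           1 + (of_real r * z) * deriv H (of_real r * z) / H (of_real r * z)"
proof -
  note rz = dilate_in_disc[OF r]
  have "starlike_quot (\<lambda>z. f (of_real r * z) / of_real r) z =
          1 + z * deriv (\<lambda>z. H (of_real r * z)) z / H (of_real r * z)"
  proof (rule starlike_quot_times_ident[OF _ _ _ z])
    show "(\<lambda>z. H (of_real r * z)) holomorphic_on unit_disc"
      by (rule holomorphic_on_dilation[OF hol r])
  qed (use rz nz f r in auto)
  moreover have "deriv (\<lambda>z. H (of_real r * z)) z = of_real r * deriv H (of_real r * z)"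
  proof (rule DERIV_imp_deriv)
    have "(H has_field_derivative deriv H (of_real r * z)) (at (of_real r * z))"
      using hol rz[OF z] by (intro holomorphic_derivI[where S = unit_disc]) auto
    moreover have "((\<lambda>z. of_real r * z) has_field_derivative of_real r) (at z)"
      by (auto intro!: derivative_eq_intros)
    ultimately show "((\<lambda>z. H (of_real r * z)) has_field_derivative
                       of_real r * deriv H (of_real r * z)) (at z)"
      using DERIV_chain2 by (metis mult.commute)
  qed
  ultimately show ?thesis by (simp add: mult_ac)
qed

text \<open>
  The Schwarz map is found by solving \<open>q = (1 + (1 - 2 * \<alpha>) * w) / (1 - w)\<close> for \<open>w\<close>. Its
  modulus is the quotient of the distances of \<open>q\<close> from \<open>1\<close> and from \<open>2 * \<alpha> - 1\<close>. These
  points are mirror images in the line \<open>Re = \<alpha>\<close>, so \<open>norm w < 1\<close> says that \<open>Re q > \<alpha>\<close>. The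
  Schwarz lemma improves this to \<open>norm (w z) \<le> norm z\<close>, because \<open>q 0 = 1\<close>.
\<close>

lemma starlike_order_if_starlike_disc:
  assumes f: "f \<in> starlike_disc \<alpha>"
    and hol: "starlike_quot f holomorphic_on unit_disc" and q0: "starlike_quot f 0 = 1"
    and \<alpha>: "\<alpha> < 1"
  shows "f \<in> starlike_order \<alpha>"
proof -
  define q where "q = starlike_quot f"
  define w where "w = (\<lambda>z. (q z - 1) / (q z - (2 * of_real \<alpha> - 1)))"
  have bd: "norm (q z - 1) < 1 - \<alpha>" if "z \<in> unit_disc" for z
    using f that by (auto simp: starlike_disc_def q_def)
  have re: "Re (q z) > \<alpha>" if "z \<in> unit_disc" for z
    using bd[OF that] abs_Re_le_cmod[of "q z - 1"] by simp
  have nz: "q z - (2 * of_real \<alpha> - 1) \<noteq> 0" if "z \<in> unit_disc" for z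
  proof -
    have "Re (q z - (2 * of_real \<alpha> - 1)) > 0"
      using re[OF that] \<alpha> by simp
    then show ?thesis by force
  qed
  have less: "norm (w z) < 1" if "z \<in> unit_disc" for z
  proof -
    have "(norm (q z - 1))\<^sup>2 < (norm (q z - (2 * of_real \<alpha> - 1)))\<^sup>2"
    proof -
      have "(norm (q z - (2 * of_real \<alpha> - 1)))\<^sup>2 - (norm (q z - 1))\<^sup>2
              = 4 * (1 - \<alpha>) * (Re (q z) - \<alpha>)"
        by (simp add: cmod_power2) (simp add: power2_eq_square algebra_simps)
      moreover have "\<dots> > 0"
        using re[OF that] \<alpha> by simp
      ultimately show ?thesis by linarith
    qed
    then have "norm (q z - 1) < norm (q z - (2 * of_real \<alpha> - 1))"
      by (rule power_less_imp_less_base) simp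
    then show ?thesis
      using nz[OF that] by (simp add: w_def norm_divide)
  qed
  have holw: "w holomorphic_on unit_disc"
    unfolding w_def using hol nz by (intro holomorphic_intros) (auto simp: q_def)
  have w0: "w 0 = 0" by (simp add: w_def q_def q0)
  have le: "norm (w z) \<le> norm z" if "z \<in> unit_disc" for z
    using Schwarz_Lemma(1)[OF holw w0, of z] less that by auto
  have eq: "q z = (1 + (1 - 2 * of_real \<alpha>) * w z) / (1 - w z)" if "z \<in> unit_disc" for z
  proof -
    have "1 - w z \<noteq> 0" using less[OF that] by auto
    moreover have "q z * (1 - w z) = 1 + (1 - 2 * of_real \<alpha>) * w z"
      unfolding w_def using nz[OF that] by (simp add: divide_simps) (simp add: algebra_simps)
    ultimately show ?thesis by (simp add: field_simps)
  qed
  have "(\<lambda>z. (1 + (1 - 2 * complex_of_real \<alpha>) * z) / (1 - z)) holomorphic_on unit_disc"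
    by (intro holomorphic_intros) auto
  moreover have "w ` unit_disc \<subseteq> unit_disc"
    using less by auto
  ultimately have "starlike_quot f \<prec>\<^sub>D (\<lambda>z. (1 + (1 - 2 * of_real \<alpha>) * z) / (1 - z))"
    unfolding subordinate_def using hol holw le eq by (auto simp: q_def)
  then show ?thesis
    using f by (simp add: starlike_order_def starlike_disc_def)
qed

text \<open>The superordinate function takes the value \<open>\<alpha>\<close> only at \<open>- 1\<close>, outside the disc.\<close>

lemma starlike_order_avoids:
  assumes "f \<in> starlike_order \<alpha>" "\<alpha> < 1" "z \<in> unit_disc"
  shows "starlike_quot f z \<noteq> of_real \<alpha>"
proof
  assume eq: "starlike_quot f z = of_real \<alpha>"
  obtain w where w: "w \<in> unit_disc"
    "starlike_quot f z = (1 + (1 - 2 * of_real \<alpha>) * w) / (1 - w)"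
    using assms unfolding starlike_order_def subordinate_def by blast
  have "1 - w \<noteq> 0" using w(1) by auto
  then have "of_real (1 - \<alpha>) * (1 + w) = 0"
    using w(2) unfolding eq by (simp add: field_simps)
  then have "w = - 1"
    using assms(2) by (auto simp: add_eq_0_iff simp del: of_real_diff)
  with w(1) show False by simp
qed

section \<open>The radius for a general superordinate function\<close>

text \<open>
  With \<open>u = r * z\<close> and \<open>f u = u * H u\<close>, the starlikeness quotient of the dilation of \<open>f\<close> at \<open>z\<close>
  is \<open>1 + u * H' u / H u\<close>. The logarithmic derivative of \<open>H\<close> is the sum of those of its three
  factors, each governed by \<open>bound\<close>.
\<close>

lemma dilation_in_starlike_disc:
  fixes \<alpha> R r :: real
  assumes hol: "\<phi> holomorphic_on unit_disc"
    and nz: "\<And>z. z \<in> unit_disc \<Longrightarrow> \<phi> z \<noteq> 0"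
    and bound: "\<And>w z. Schwarz_map w \<Longrightarrow> norm z < R \<Longrightarrow>
                  3 * norm (z * deriv w z * deriv \<phi> (w z) / \<phi> (w z)) < 1 - \<alpha>"
    and f: "f \<in> class_T \<phi>" and r: "0 < r" "r \<le> R" and R: "R \<le> 1" and \<alpha>: "\<alpha> < 1"
  defines "fr \<equiv> \<lambda>z. f (of_real r * z) / of_real r"
  shows "fr \<in> starlike_disc \<alpha>" and "fr \<in> starlike_order \<alpha>"
proof -
  have r1: "r \<le> 1" using r R by simp
  note rz = dilate_in_disc[OF r(1) r1]
  obtain w1 w2 w3 where w: "Schwarz_map w1" "Schwarz_map w2" "Schwarz_map w3"
    and feq: "\<And>z. z \<in> unit_disc \<Longrightarrow> f z = z * (\<phi> (w1 z) * \<phi> (w2 z) * \<phi> (w3 z))"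
    using class_T_factorization[OF nz f] by blast
  define H where "H = (\<lambda>z. \<phi> (w1 z) * \<phi> (w2 z) * \<phi> (w3 z))"
  have feq: "f z = z * H z" if "z \<in> unit_disc" for z
    using feq[OF that] by (simp add: H_def)
  have holH: "H holomorphic_on unit_disc"
    unfolding H_def by (intro holomorphic_on_mult holomorphic_compose_Schwarz_map[OF hol] w)
  have nz_w: "\<phi> (w z) \<noteq> 0" if "Schwarz_map w" "z \<in> unit_disc" for w z
    using that nz Schwarz_mapD(2)[OF that(1), of z] by auto
  have nzH: "H z \<noteq> 0" if "z \<in> unit_disc" for z
    using nz_w that w by (simp add: H_def)
  have holf: "f holomorphic_on unit_disc" and f0: "f 0 = 0" and df0: "deriv f 0 = 1"
    using f by (auto simp: class_T_def class_A_def)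
  have sq: "starlike_quot fr z =
      1 + (of_real r * z) * deriv H (of_real r * z) / H (of_real r * z)" if "z \<in> unit_disc" for z
    unfolding fr_def using holH nzH feq r(1) r1 that by (rule starlike_quot_dilation)
  have holfr': "(\<lambda>z. f (of_real r * z)) holomorphic_on unit_disc"
    by (rule holomorphic_on_dilation[OF holf r(1) r1])
  have frA: "fr \<in> class_A"
  proof -
    have "(f has_field_derivative 1) (at 0)"
      using holomorphic_derivI[OF holf, of 0] df0 by simp
    then have d: "(f has_field_derivative 1) (at (of_real r * 0))" by simp
    have "((\<lambda>z. of_real r * z) has_field_derivative of_real r) (at 0)"
      by (auto intro!: derivative_eq_intros)
    from DERIV_chain2[OF d this] have "(fr has_field_derivative 1 * of_real r / of_real r) (at 0)"
      unfolding fr_def by (rule DERIV_cdivide)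
    then have "deriv fr 0 = 1"
      using r by (intro DERIV_imp_deriv) simp
    moreover have "fr holomorphic_on unit_disc"
      unfolding fr_def using r by (intro holomorphic_intros holfr') auto
    ultimately show ?thesis
      by (simp add: class_A_def fr_def f0)
  qed
  have bd: "norm (starlike_quot fr z - 1) < 1 - \<alpha>" if z: "z \<in> unit_disc" for z
  proof -
    define u where "u = of_real r * z"
    have u: "u \<in> unit_disc" using rz[OF z] by (simp add: u_def)
    have uR: "norm u < R"
    proof -
      have "norm u < r" using z r by (simp add: u_def norm_mult)
      then show ?thesis using r by simp
    qed
    define L where "L = (\<lambda>w. u * deriv w u * deriv \<phi> (w u) / \<phi> (w u))"
    have d: "((\<lambda>z. \<phi> (w z)) has_field_derivative deriv \<phi> (w u) * deriv w u) (at u)"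
      if "Schwarz_map w" for w
    proof (rule DERIV_chain2[where f = \<phi> and g = w])
      show "(\<phi> has_field_derivative deriv \<phi> (w u)) (at (w u))"
        using hol Schwarz_mapD(2)[OF that, of u] u
        by (intro holomorphic_derivI[where S = unit_disc]) auto
      show "(w has_field_derivative deriv w u) (at u)"
        using Schwarz_mapD(1)[OF that] u by (intro holomorphic_derivI[where S = unit_disc]) auto
    qed
    have "deriv H u = deriv \<phi> (w1 u) * deriv w1 u * \<phi> (w2 u) * \<phi> (w3 u)
        + deriv \<phi> (w2 u) * deriv w2 u * \<phi> (w1 u) * \<phi> (w3 u)
        + deriv \<phi> (w3 u) * deriv w3 u * \<phi> (w1 u) * \<phi> (w2 u)"
      unfolding H_def
      by (rule DERIV_imp_deriv, (rule derivative_eq_intros d w refl)+) (simp add: algebra_simps)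
    then have "u * deriv H u / H u = L w1 + L w2 + L w3"
      using nz_w[OF w(1) u] nz_w[OF w(2) u] nz_w[OF w(3) u]
      by (simp add: L_def H_def divide_simps) (simp add: algebra_simps)
    then have "starlike_quot fr z - 1 = L w1 + L w2 + L w3"
      using sq[OF z] by (simp add: u_def)
    then have "norm (starlike_quot fr z - 1) \<le> norm (L w1) + norm (L w2) + norm (L w3)"
      by (metis norm_add_rule_thm norm_triangle_ineq order_refl)
    then show ?thesis
      using bound[OF w(1) uR] bound[OF w(2) uR] bound[OF w(3) uR] by (simp add: L_def)
  qed
  then show disc: "fr \<in> starlike_disc \<alpha>"
    using frA by (simp add: starlike_disc_def)
  have "(\<lambda>z. 1 + z * deriv H z / H z) holomorphic_on unit_disc"
    by (intro holomorphic_intros holH) (use nzH in auto)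
  then have "(\<lambda>z. 1 + (of_real r * z) * deriv H (of_real r * z) / H (of_real r * z))
               holomorphic_on unit_disc"
    using holomorphic_on_dilation r(1) r1 by blast
  then have "starlike_quot fr holomorphic_on unit_disc"
    using sq by (subst holomorphic_cong[OF refl]) auto
  then show "fr \<in> starlike_order \<alpha>"
    using sq[of 0] \<alpha> by (intro starlike_order_if_starlike_disc[OF disc]) auto
qed

text \<open>
  The assumption \<open>sharp\<close> says that the starlikeness quotient of \<open>z * \<phi> z ^ 3\<close> equals \<open>\<alpha>\<close> at
  \<open>- R\<close>. After dilation by \<open>r\<close> with \<open>R < r \<le> 1\<close> this value is attained at the interior point \<open>- R / r\<close>,
  whereas both target classes exclude it in the open disc.
\<close>

lemma radius_class_T:
  fixes \<alpha> R :: real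
  assumes hol: "\<phi> holomorphic_on unit_disc"
    and nz: "\<And>z. z \<in> unit_disc \<Longrightarrow> \<phi> z \<noteq> 0"
    and one: "\<phi> 0 = 1"
    and R: "0 < R" "R < 1" and \<alpha>: "\<alpha> < 1"
    and bound: "\<And>w z. Schwarz_map w \<Longrightarrow> norm z < R \<Longrightarrow>
                  3 * norm (z * deriv w z * deriv \<phi> (w z) / \<phi> (w z)) < 1 - \<alpha>"
    and sharp: "3 * of_real R * deriv \<phi> (- of_real R) / \<phi> (- of_real R) = of_real (1 - \<alpha>)"
  shows "is_radius (starlike_order \<alpha>) (class_T \<phi>) R \<and> is_radius (starlike_disc \<alpha>) (class_T \<phi>) R"
proof -
  have adm: "radius_admissible (starlike_order \<alpha>) (class_T \<phi>) R"
    "radius_admissible (starlike_disc \<alpha>) (class_T \<phi>) R"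
    unfolding radius_admissible_def
    using R \<alpha> dilation_in_starlike_disc[OF hol nz bound] by auto
  have touch: "\<exists>f\<in>class_T \<phi>. \<exists>z\<in>unit_disc.
      starlike_quot (\<lambda>z. f (of_real r * z) / of_real r) z = of_real \<alpha>"
    if r: "R < r" "r \<le> 1" for r
  proof (intro bexI)
    show "(\<lambda>z. z * \<phi> z ^ 3) \<in> class_T \<phi>"
      by (rule cube_in_class_T[OF hol nz one])
    define z where "z = - complex_of_real (R / r)"
    show z: "z \<in> unit_disc"
      using R r by (simp add: z_def norm_divide)
    have rz: "of_real r * z = - of_real R"
      using R r by (simp add: z_def)
    have R_in: "- complex_of_real R \<in> unit_disc" using R by simp
    have "(\<phi> has_field_derivative deriv \<phi> (- of_real R)) (at (- of_real R))"
      using hol R_in by (intro holomorphic_derivI[where S = unit_disc]) auto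
    then have "deriv (\<lambda>z. \<phi> z ^ 3) (- of_real R)
                 = 3 * deriv \<phi> (- of_real R) * \<phi> (- of_real R) ^ 2"
      by (intro DERIV_imp_deriv) (auto intro!: derivative_eq_intros)
    moreover have "starlike_quot (\<lambda>z. (of_real r * z * \<phi> (of_real r * z) ^ 3) / of_real r) z
        = 1 + (- of_real R) * deriv (\<lambda>z. \<phi> z ^ 3) (- of_real R) / \<phi> (- of_real R) ^ 3"
      using starlike_quot_dilation[where H = "\<lambda>z. \<phi> z ^ 3" and f = "\<lambda>z. z * \<phi> z ^ 3",
          OF _ _ refl _ r(2) z] hol nz R r
      unfolding rz by (auto intro!: holomorphic_intros)
    ultimately have "starlike_quot (\<lambda>z. (of_real r * z * \<phi> (of_real r * z) ^ 3) / of_real r) z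
        = 1 - 3 * of_real R * deriv \<phi> (- of_real R) / \<phi> (- of_real R)"
      using nz[OF R_in] by (simp add: power2_eq_square power3_eq_cube)
    then show "starlike_quot (\<lambda>z. (of_real r * z * \<phi> (of_real r * z) ^ 3) / of_real r) z
        = of_real \<alpha>"
      unfolding sharp by simp
  qed
  have "R' \<le> R" if "radius_admissible (starlike_order \<alpha>) (class_T \<phi>) R'" for R'
  proof (rule ccontr)
    assume "\<not> R' \<le> R"
    then obtain f z where "f \<in> class_T \<phi>" "z \<in> unit_disc"
      "starlike_quot (\<lambda>z. f (of_real R' * z) / of_real R') z = of_real \<alpha>"
      using touch[of R'] \<open>radius_admissible _ _ R'\<close> by (auto simp: radius_admissible_def)
    then show False
      using starlike_order_avoids \<alpha> \<open>radius_admissible _ _ R'\<close>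
      unfolding radius_admissible_def by blast
  qed
  moreover have "R' \<le> R" if "radius_admissible (starlike_disc \<alpha>) (class_T \<phi>) R'" for R'
  proof (rule ccontr)
    assume "\<not> R' \<le> R"
    then obtain f z where fz: "f \<in> class_T \<phi>" "z \<in> unit_disc"
      and eq: "starlike_quot (\<lambda>z. f (of_real R' * z) / of_real R') z = of_real \<alpha>"
      using touch[of R'] \<open>radius_admissible _ _ R'\<close> by (auto simp: radius_admissible_def)
    then have "(\<lambda>z. f (of_real R' * z) / of_real R') \<in> starlike_disc \<alpha>"
      using \<open>radius_admissible _ _ R'\<close> unfolding radius_admissible_def by blast
    then have "norm (complex_of_real \<alpha> - 1) < 1 - \<alpha>"
      using fz(2) eq by (force simp: starlike_disc_def)
    moreover have "norm (complex_of_real \<alpha> - 1) = \<bar>\<alpha> - 1\<bar>"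
      by (metis norm_of_real of_real_1 of_real_diff)
    ultimately show False using \<alpha> by simp
  qed
  ultimately show ?thesis
    using adm unfolding is_radius_def by blast
qed

section \<open>The two superordinate functions\<close>

lemma one_plus_not_nonpos_Reals:
  assumes "z \<in> unit_disc"
  shows "1 + z \<notin> \<real>\<^sub>\<le>\<^sub>0"
proof -
  have "Re (1 + z) > 0"
    using assms abs_Re_le_cmod[of z] by simp
  then show ?thesis by (auto simp: complex_nonpos_Reals_iff)
qed

lemma logderiv_csqrt_1_plus:
  assumes "z \<in> unit_disc"
  shows "deriv (\<lambda>z. csqrt (1 + z)) z / csqrt (1 + z) = 1 / (2 * (1 + z))"
proof -
  have "((\<lambda>z. csqrt (1 + z)) has_field_derivative 1 / (2 * csqrt (1 + z))) (at z)"
    by (rule derivative_eq_intros refl one_plus_not_nonpos_Reals assms | simp)+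
  then have "deriv (\<lambda>z. csqrt (1 + z)) z = 1 / (2 * csqrt (1 + z))"
    by (rule DERIV_imp_deriv)
  moreover have "csqrt (1 + z) * csqrt (1 + z) = 1 + z"
    by (metis power2_csqrt power2_eq_square)
  ultimately show ?thesis by (simp add: mult.assoc)
qed

text \<open>
  The Schwarz-Pick inequality and \<open>norm (1 + w) \<ge> 1 - norm w\<close> give
  \<open>norm w' / norm (1 + w) \<le> (1 + norm w) / (1 - r\<^sup>2)\<close> for \<open>r = norm z\<close>, and \<open>norm w \<le> r\<close> finishes.
\<close>

lemma Schwarz_map_sqrt_bound:
  assumes w: "Schwarz_map w" and z: "norm z < 1"
  shows "norm (z * deriv w z / (1 + w z)) \<le> norm z / (1 - norm z)"
proof -
  define s where "s = norm z"
  define t where "t = norm (w z)"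
  have st: "0 \<le> s" "s < 1" "0 \<le> t" "t \<le> s"
    using z Schwarz_mapD(3)[OF w z] by (auto simp: s_def t_def)
  have SP: "norm (deriv w z) * (1 - s\<^sup>2) \<le> 1 - t\<^sup>2"
    using Schwarz_Pick_derivative[OF Schwarz_mapD(1,2)[OF w] z] by (simp add: s_def t_def)
  have "norm (deriv w z) * (1 - s) * (1 + s) \<le> (1 - t) * (1 + t)"
    using SP by (simp add: power2_eq_square algebra_simps)
  also have "\<dots> \<le> (1 - t) * (1 + s)"
    using st by (intro mult_left_mono) auto
  finally have "norm (deriv w z) * (1 - s) \<le> 1 - t"
    using st by (simp add: mult_le_cancel_right)
  also have "1 - t \<le> norm (1 + w z)"
    using norm_diff_ineq[of 1 "w z"] by (simp add: t_def)
  finally have *: "norm (deriv w z) * (1 - s) \<le> norm (1 + w z)" .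
  have "1 + w z \<noteq> 0"
    using \<open>1 - t \<le> norm (1 + w z)\<close> st by auto
  then have "norm (deriv w z) / norm (1 + w z) \<le> 1 / (1 - s)"
    using * st by (simp add: field_simps)
  then have "s * (norm (deriv w z) / norm (1 + w z)) \<le> s * (1 / (1 - s))"
    using st by (intro mult_left_mono) auto
  then show ?thesis
    by (simp add: norm_mult norm_divide s_def)
qed

theorem theorem2p1:
  fixes \<alpha> :: real
  assumes "0 \<le> \<alpha>" and "\<alpha> < 1"
  shows "(is_radius (starlike_order \<alpha>) class_T1 (2 * (1 - \<alpha>) / (5 - 2 * \<alpha>)) \<and>
          is_radius (starlike_disc \<alpha>) class_T1 (2 * (1 - \<alpha>) / (5 - 2 * \<alpha>))) \<and>
         (is_radius (starlike_order \<alpha>) class_T2 ((1 - \<alpha>) / 3) \<and>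
          is_radius (starlike_disc \<alpha>) class_T2 ((1 - \<alpha>) / 3))"
proof
  define R where "R = 2 * (1 - \<alpha>) / (5 - 2 * \<alpha>)"
  have R: "0 < R" "R < 1"
    using assms by (auto simp: R_def field_simps)
  \<comment> \<open>the equation \<open>R / (2 * (1 - R)) = (1 - \<alpha>) / 3\<close> that determines \<open>R\<close>\<close>
  have R_eq: "3 * R = 2 * (1 - \<alpha>) * (1 - R)"
    using assms by (simp add: R_def field_simps)
  show "is_radius (starlike_order \<alpha>) class_T1 (2 * (1 - \<alpha>) / (5 - 2 * \<alpha>)) \<and>
        is_radius (starlike_disc \<alpha>) class_T1 (2 * (1 - \<alpha>) / (5 - 2 * \<alpha>))"
    unfolding class_T1_def R_def[symmetric]
  proof (rule radius_class_T[OF _ _ _ R assms(2)])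
    show "(\<lambda>z. csqrt (1 + z)) holomorphic_on unit_disc"
      by (intro holomorphic_intros one_plus_not_nonpos_Reals)
    show "csqrt (1 + z) \<noteq> 0" if "z \<in> unit_disc" for z
      using one_plus_not_nonpos_Reals[OF that] by auto
    show "3 * norm (z * deriv w z * deriv (\<lambda>z. csqrt (1 + z)) (w z) / csqrt (1 + w z)) < 1 - \<alpha>"
      if w: "Schwarz_map w" and z: "norm z < R" for w z
    proof -
      have z1: "norm z < 1" using z R by simp
      have wz: "w z \<in> unit_disc" using Schwarz_mapD(2)[OF w z1] by simp
      have "z * deriv w z * deriv (\<lambda>z. csqrt (1 + z)) (w z) / csqrt (1 + w z)
              = z * deriv w z * (1 / (2 * (1 + w z)))"
        by (simp only: logderiv_csqrt_1_plus[OF wz] flip: times_divide_eq_right)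
      also have "norm \<dots> = norm (z * deriv w z / (1 + w z)) / 2"
        by (simp add: norm_mult norm_divide del: distrib_left_numeral)
      also have "\<dots> \<le> norm z / (1 - norm z) / 2"
        using Schwarz_map_sqrt_bound[OF w z1] by (rule divide_right_mono) simp
      also have "\<dots> < (1 - \<alpha>) / 3"
      proof -
        have "3 * norm z < 3 * R" using z by simp
        also have "\<dots> \<le> 2 * (1 - \<alpha>) * (1 - norm z)"
          unfolding R_eq using z assms by (intro mult_left_mono) auto
        finally have "norm z < (1 - \<alpha>) / 3 * (2 * (1 - norm z))" by (simp add: field_simps)
        then show ?thesis
          using z1 by (subst divide_divide_eq_left, subst pos_divide_less_eq) (auto simp: mult.commute)
      qed
      finally show ?thesis by simp
    qed
    have R_in: "- complex_of_real R \<in> unit_disc" using R by simp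
    have "3 * of_real R * deriv (\<lambda>z. csqrt (1 + z)) (- of_real R) / csqrt (1 + - of_real R)
            = 3 * of_real R * (1 / (2 * (1 + - complex_of_real R)))"
      by (simp only: logderiv_csqrt_1_plus[OF R_in] flip: times_divide_eq_right)
    also have "\<dots> = of_real (3 * R / (2 * (1 - R)))" by simp
    also have "3 * R / (2 * (1 - R)) = 1 - \<alpha>"
      unfolding R_eq using R by (simp add: field_simps)
    finally show "3 * of_real R * deriv (\<lambda>z. csqrt (1 + z)) (- of_real R)
                    / csqrt (1 + - of_real R) = of_real (1 - \<alpha>)" .
  qed simp
next
  have deriv_exp: "deriv exp z = exp z" for z :: complex
    by (rule DERIV_imp_deriv) (rule DERIV_exp)
  show "is_radius (starlike_order \<alpha>) class_T2 ((1 - \<alpha>) / 3) \<and>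
        is_radius (starlike_disc \<alpha>) class_T2 ((1 - \<alpha>) / 3)"
    unfolding class_T2_def
  proof (rule radius_class_T)
    show "3 * norm (z * deriv w z * deriv exp (w z) / exp (w z)) < 1 - \<alpha>"
      if w: "Schwarz_map w" and z: "norm z < (1 - \<alpha>) / 3" for w z
    proof -
      have third: "norm z < 1 / 3" using z assms(1) by simp
      \<comment> \<open>the range of Dieudonne's theorem contains the disc of radius \<open>1 / 3\<close>\<close>
      have "(norm z)\<^sup>2 \<le> (1 / 3)\<^sup>2"
        using third by (intro power_mono) auto
      then have "2 * norm z \<le> 1 - (norm z)\<^sup>2"
        using third by (simp add: power2_eq_square)
      then have "norm (deriv w z) \<le> 1"
        using third by (intro Schwarz_map_deriv_le_1[OF w]) auto
      then have "norm z * norm (deriv w z) \<le> norm z"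
        by (simp add: mult_left_le)
      then show ?thesis
        using z by (simp add: deriv_exp norm_mult)
    qed
  qed (use assms in \<open>auto simp: deriv_exp intro!: holomorphic_intros\<close>)
qed

end
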